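(* Let $M \ge 2$, $N\ge1$ be integers with $\operatorname{rad}(M) \nmid \operatorname{rad}(N)$, let $\xi$ be a primitive $M$-th root of unity, let $r\ge1$, let $p_1, \dots, p_r$ be non-negative integers, let $x_1, \dots, x_r, y_1, \dots, y_r\in\mathbb{C}$, and let $D_r = \sum_{j=1}^r (p_j+1)$. Then $$\sum_{n_1=0}^{M^{p_1+1}-1}\cdots\sum_{n_r=0}^{M^{p_r+1}-1} \xi^{\sum_{j=1}^r \mathcal{B}_{M,N}(n_j)} \Big( \sum_{j=1}^r \big(\mathcal{B}_{M,N}(n_j)x_j + n_j y_j\big) \Big)^{D_r} = (-1)^{D_r} D_r!\, M^{D_r} \frac{\prod_{j=1}^r \prod_{i=0}^{p_j} \big(N^i x_j + M^i y_j \big)}{\prod_{j=1}^r \prod_{i=0}^{p_j} \big(1-\xi^{N^i}\big)}.$$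
   Context: For integers $M\ge 2$, $N \ge 1$ and $n\ge 0$ with base-$M$ expansion $n=\sum_{i\ge 0} d_i(n) M^i$, $d_i(n)\in\{0,\dots,M-1\}$, the base-shifting map is $\mathcal{B}_{M,N}(n) := \sum_{i\ge 0} d_i(n) N^i$. $\operatorname{rad}(k)$ is the product of the distinct prime factors of $k$. *)

theory Defs
  imports Complex_Main "HOL-Library.FuncSet" "HOL-Computational_Algebra.Primes"
begin

definition digit :: "nat \<Rightarrow> nat \<Rightarrow> nat \<Rightarrow> nat" where
  "digit M n i = n div M ^ i mod M"

text \<open>The formal sum over all \<open>i\<close> is taken over its support, which is finite for \<open>M \<ge> 2\<close>
  (see \<open>finite_digit_support\<close> below).\<close>

definition base_shift :: "nat \<Rightarrow> nat \<Rightarrow> nat \<Rightarrow> nat" where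
  "base_shift M N n = (\<Sum>i | digit M n i \<noteq> 0. digit M n i * N ^ i)"

definition rad :: "nat \<Rightarrow> nat" where
  "rad k = \<Prod>(prime_factors k)"

definition primitive_root_of_unity :: "nat \<Rightarrow> complex \<Rightarrow> bool" where
  "primitive_root_of_unity m z \<longleftrightarrow> m > 0 \<and> z ^ m = 1 \<and> (\<forall>k. 0 < k \<and> k < m \<longrightarrow> z ^ k \<noteq> 1)"

lemma digit_support_subset:
  assumes "M \<ge> 2"
  shows "{i. digit M n i \<noteq> 0} \<subseteq> {..<n}"
proof
  fix i assume i: "i \<in> {i. digit M n i \<noteq> 0}"
  show "i \<in> {..<n}"
  proof (rule ccontr)
    assume "i \<notin> {..<n}"
    then have "n \<le> i" by simp
    also have "i < 2 ^ i" by (rule less_exp)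
    also have "(2::nat) ^ i \<le> M ^ i" using assms by (rule power_mono) simp
    finally show False using i by (simp add: digit_def)
  qed
qed

lemma finite_digit_support:
  "M \<ge> 2 \<Longrightarrow> finite {i. digit M n i \<noteq> 0}"
  using digit_support_subset finite_subset by blast

lemma base_shift_same:
  assumes "M \<ge> 2"
  shows "base_shift M M n = n"
proof -
  have partial: "(\<Sum>i<k. digit M n i * M ^ i) = n mod M ^ k" for k
  proof (induction k)
    case (Suc k)
    then show ?case
      using mod_mult2_eq[of n "M ^ k" M] by (simp add: digit_def mult.commute)
  qed simp
  have "base_shift M M n = (\<Sum>i<n. digit M n i * M ^ i)"
    unfolding base_shift_def
    by (rule sum.mono_neutral_left) (use digit_support_subset[OF assms] in auto)
  also have "\<dots> = n mod M ^ n" by (rule partial)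
  also have "n < M ^ n"
    using assms less_exp[of n] power_mono[of 2 M n] by linarith
  then have "n mod M ^ n = n" by simp
  finally show ?thesis .
qed

end

theory Submission
  imports Defs
begin

text \<open>
  Writing every \<open>n\<^sub>j\<close> in base \<open>M\<close> turns the sum into one over independent digits \<open>d\<close>, one for each
  of the \<open>D\<close> pairs \<open>(j, i)\<close>: the digit contributes the weight \<open>w ^ d\<close> with \<open>w = \<xi> ^ (N ^ i)\<close>, and the
  value \<open>d * a\<close> with \<open>a = N ^ i * x\<^sub>j + M ^ i * y\<^sub>j\<close>. The hypothesis on radicals says that \<open>M\<close> divides
  no power of \<open>N\<close>, so \<open>w \<noteq> 1\<close>, the total weight of a digit vanishes and its first moment is
  \<open>- a * M / (1 - w)\<close>. Orders of vanishing of moments add under independent sums, and the leading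
  coefficients multiply.
\<close>

text \<open>
  \<open>L\<close> is the coefficient of \<open>t ^ d\<close> in the series \<open>\<Sum>a\<in>A. W a * exp (t * V a)\<close>, all lower
  coefficients of which vanish.
\<close>

definition leading_moment ::
    "'a set \<Rightarrow> ('a \<Rightarrow> complex) \<Rightarrow> ('a \<Rightarrow> complex) \<Rightarrow> nat \<Rightarrow> complex \<Rightarrow> bool" where
  "leading_moment A W V d L \<longleftrightarrow>
     (\<forall>m<d. (\<Sum>a\<in>A. W a * V a ^ m) = 0) \<and> (\<Sum>a\<in>A. W a * V a ^ d) = fact d * L"

text \<open>By the binomial theorem the moments of a sum of independent values are the binomial
  convolution of the two moment sequences, which is the product of the two exponential
  series.\<close>

lemma leading_moment_times:
  assumes A: "leading_moment A W V d L" and B: "leading_moment B W' V' e L'"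
  shows "leading_moment (A \<times> B) (\<lambda>(a, b). W a * W' b) (\<lambda>(a, b). V a + V' b) (d + e) (L * L')"
proof -
  define S where "S = (\<lambda>m. \<Sum>a\<in>A. W a * V a ^ m)"
  define T where "T = (\<lambda>m. \<Sum>b\<in>B. W' b * V' b ^ m)"
  have S0: "S m = 0" if "m < d" for m using A that by (simp add: leading_moment_def S_def)
  have T0: "T m = 0" if "m < e" for m using B that by (simp add: leading_moment_def T_def)
  have Sd: "S d = fact d * L" using A by (simp add: leading_moment_def S_def)
  have Te: "T e = fact e * L'" using B by (simp add: leading_moment_def T_def)
  have moment: "(\<Sum>z\<in>A \<times> B. (case z of (a, b) \<Rightarrow> W a * W' b) * (case z of (a, b) \<Rightarrow> V a + V' b) ^ m)
      = (\<Sum>k\<le>m. of_nat (m choose k) * S k * T (m - k))" for m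
  proof -
    have "(\<Sum>z\<in>A \<times> B. (case z of (a, b) \<Rightarrow> W a * W' b) * (case z of (a, b) \<Rightarrow> V a + V' b) ^ m)
        = (\<Sum>z\<in>A \<times> B. case z of (a, b) \<Rightarrow> W a * W' b * (V a + V' b) ^ m)"
      by (rule sum.cong) auto
    also have "\<dots> = (\<Sum>a\<in>A. \<Sum>b\<in>B. W a * W' b * (V a + V' b) ^ m)"
      by (simp add: sum.cartesian_product)
    also have "\<dots> = (\<Sum>a\<in>A. \<Sum>b\<in>B. \<Sum>k\<le>m.
        of_nat (m choose k) * (W a * V a ^ k) * (W' b * V' b ^ (m - k)))"
      by (simp add: binomial_ring sum_distrib_left mult_ac)
    also have "\<dots> = (\<Sum>a\<in>A. \<Sum>k\<le>m. \<Sum>b\<in>B.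
        of_nat (m choose k) * (W a * V a ^ k) * (W' b * V' b ^ (m - k)))"
      by (rule sum.cong[OF refl], rule sum.swap)
    also have "\<dots> = (\<Sum>k\<le>m. \<Sum>a\<in>A. \<Sum>b\<in>B.
        of_nat (m choose k) * (W a * V a ^ k) * (W' b * V' b ^ (m - k)))"
      by (rule sum.swap)
    also have "\<dots> = (\<Sum>k\<le>m. of_nat (m choose k) * S k * T (m - k))"
      unfolding S_def T_def mult.assoc by (simp only: sum_product) (simp only: sum_distrib_left mult.assoc)
    finally show ?thesis .
  qed
  have low: "(\<Sum>k\<le>m. of_nat (m choose k) * S k * T (m - k)) = 0" if "m < d + e" for m
  proof (rule sum.neutral, rule ballI)
    fix k assume "k \<in> {..m}"
    then have "k < d \<or> m - k < e" using that by auto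
    then show "of_nat (m choose k) * S k * T (m - k) = 0" using S0 T0 by auto
  qed
  \<comment> \<open>At total order \<open>d + e\<close>, any index other than \<open>k = d\<close>
    puts one of the two factors below its order of vanishing.\<close>
  have "(\<Sum>k\<le>d + e. of_nat (d + e choose k) * S k * T (d + e - k))
      = (\<Sum>k\<in>{d}. of_nat (d + e choose k) * S k * T (d + e - k))"
  proof (rule sum.mono_neutral_right)
    show "\<forall>k\<in>{..d + e} - {d}. of_nat (d + e choose k) * S k * T (d + e - k) = 0"
    proof
      fix k assume "k \<in> {..d + e} - {d}"
      then have "k < d \<or> d + e - k < e" by auto
      then show "of_nat (d + e choose k) * S k * T (d + e - k) = 0" using S0 T0 by auto
    qed
  qed auto
  also have "\<dots> = of_nat (fact d * fact e * (d + e choose d)) * (L * L')"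
    by (simp add: Sd Te)
  also have "fact d * fact e * (d + e choose d) = fact (d + e)"
    using binomial_fact_lemma[of d "d + e"] by simp
  finally show ?thesis
    unfolding leading_moment_def moment using low by simp
qed

lemma leading_moment_reindex:
  assumes "leading_moment A W V d L" and "bij_betw h A B"
    and "\<And>a. a \<in> A \<Longrightarrow> W' (h a) = W a" and "\<And>a. a \<in> A \<Longrightarrow> V' (h a) = V a"
  shows "leading_moment B W' V' d L"
proof -
  have "(\<Sum>b\<in>B. W' b * V' b ^ m) = (\<Sum>a\<in>A. W a * V a ^ m)" for m
    using sum.reindex_bij_betw[OF assms(2), of "\<lambda>b. W' b * V' b ^ m"] assms(3,4) by simp
  then show ?thesis using assms(1) by (simp add: leading_moment_def)
qed

lemma sum_of_nat_mult_power_root_of_unity: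
  fixes w :: complex
  assumes "w ^ M = 1" and "w \<noteq> 1"
  shows "(\<Sum>q<M. w ^ q * of_nat q) = - of_nat M / (1 - w)"
proof -
  \<comment> \<open>The factor \<open>1 - w\<close> telescopes the sum to a geometric one plus a
    boundary term; at \<open>m = M\<close> the geometric sum vanishes and only the boundary
    survives.\<close>
  have "(\<Sum>q<m. w ^ q * of_nat q) * (1 - w) = w * (\<Sum>q<m. w ^ q) - of_nat m * w ^ m" for m
  proof (induction m)
    case (Suc m)
    have "(\<Sum>q<Suc m. w ^ q * of_nat q) * (1 - w)
        = (\<Sum>q<m. w ^ q * of_nat q) * (1 - w) + w ^ m * of_nat m * (1 - w)"
      by (simp add: distrib_right)
    also have "\<dots> = w * (\<Sum>q<Suc m. w ^ q) - of_nat (Suc m) * w ^ Suc m"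
      unfolding Suc.IH by (simp add: algebra_simps)
    finally show ?case .
  qed simp
  from this[of M] have "(\<Sum>q<M. w ^ q * of_nat q) * (1 - w) = - of_nat M"
    using assms by (simp add: sum_gp_strict)
  then show ?thesis using assms(2) by (subst nonzero_eq_divide_eq) auto
qed

lemma leading_moment_digit:
  fixes w a :: complex
  assumes "w ^ M = 1" and "w \<noteq> 1"
  shows "leading_moment {..<M} (\<lambda>q. w ^ q) (\<lambda>q. of_nat q * a) 1 (- (of_nat M * a) / (1 - w))"
proof -
  have "(\<Sum>q<M. w ^ q) = 0" using assms by (simp add: sum_gp_strict)
  moreover have "(\<Sum>q<M. w ^ q * (of_nat q * a)) = - (of_nat M * a) / (1 - w)"
    using sum_of_nat_mult_power_root_of_unity[OF assms]
    by (simp add: sum_distrib_right[symmetric] mult.assoc[symmetric])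
  ultimately show ?thesis by (simp add: leading_moment_def)
qed

text \<open>Replaces the support, which depends on \<open>n\<close>, by a fixed range of positions:
  those from \<open>k\<close> on hold the digit 0.\<close>

lemma base_shift_eq_sum:
  assumes "M \<ge> 2" and "n < M ^ k"
  shows "base_shift M N n = (\<Sum>i<k. digit M n i * N ^ i)"
  unfolding base_shift_def
proof (rule sum.mono_neutral_left)
  show "{i. digit M n i \<noteq> 0} \<subseteq> {..<k}"
  proof
    fix i assume i: "i \<in> {i. digit M n i \<noteq> 0}"
    show "i \<in> {..<k}"
    proof (rule ccontr)
      assume "i \<notin> {..<k}"
      then have "M ^ k \<le> M ^ i" using assms(1) by (intro power_increasing) auto
      then show False using i assms(2) by (simp add: digit_def)
    qed
  qed
qed auto

lemma base_shift_add_top_digit: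
  assumes "M \<ge> 2" and "n < M ^ k" and "q < M"
  shows "base_shift M N (n + q * M ^ k) = base_shift M N n + q * N ^ k"
proof -
  have "n + q * M ^ k < M ^ k + q * M ^ k" using assms(2) by simp
  also have "\<dots> = Suc q * M ^ k" by simp
  also have "\<dots> \<le> M * M ^ k" using assms(3) by (intro mult_right_mono) auto
  finally have bound: "n + q * M ^ k < M ^ Suc k" by simp
  have low: "digit M (n + q * M ^ k) i = digit M n i" if i: "i < k" for i
  proof -
    \<comment> \<open>Besides \<open>M ^ i\<close>, the term \<open>q * M ^ k\<close> contains one
      more factor \<open>M\<close>, so it changes the quotient by a multiple of \<open>M\<close> and
      leaves digit \<open>i\<close> alone.\<close>
    obtain l where l: "k = Suc i + l" using less_imp_Suc_add[OF i] by auto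
    have "n + q * M ^ k = n + (q * M ^ l * M) * M ^ i" by (simp add: l power_add mult_ac)
    moreover have "(n + (q * M ^ l * M) * M ^ i) div M ^ i = n div M ^ i + q * M ^ l * M"
      using assms(1) by (subst div_mult_self1) auto
    ultimately have "(n + q * M ^ k) div M ^ i = n div M ^ i + q * M ^ l * M"
      by (simp only:)
    then show ?thesis by (simp add: digit_def)
  qed
  have top: "digit M (n + q * M ^ k) k = q" using assms by (simp add: digit_def)
  show ?thesis
    by (simp add: base_shift_eq_sum[OF assms(1) bound] base_shift_eq_sum[OF assms(1,2)] low top)
qed

lemma bij_betw_top_digit:
  fixes M :: nat
  assumes "M > 0"
  shows "bij_betw (\<lambda>(n, q). n + q * M ^ k) ({..<M ^ k} \<times> {..<M}) {..<M ^ Suc k}"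
proof (rule bij_betw_byWitness[where f' = "\<lambda>n. (n mod M ^ k, n div M ^ k)"])
  show "(\<lambda>(n, q). n + q * M ^ k) ` ({..<M ^ k} \<times> {..<M}) \<subseteq> {..<M ^ Suc k}"
  proof clarsimp
    fix n q assume "n < M ^ k" "q < M"
    then have "n + q * M ^ k < Suc q * M ^ k" by simp
    also have "\<dots> \<le> M * M ^ k" using \<open>q < M\<close> by (intro mult_right_mono) auto
    finally show "n + q * M ^ k < M * M ^ k" .
  qed
  show "(\<lambda>n. (n mod M ^ k, n div M ^ k)) ` {..<M ^ Suc k} \<subseteq> {..<M ^ k} \<times> {..<M}"
    using assms by (auto simp: less_mult_imp_div_less)
qed (use assms in \<open>auto simp: mod_div_mult_eq\<close>)

text \<open>Induction on the number of digits: the top digit ranges independently of the lower ones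
  and raises the order of vanishing by one.\<close>

lemma leading_moment_base_shift:
  fixes x y \<xi> :: complex
  assumes M: "M \<ge> 2" and root: "\<xi> ^ M = 1" and nontriv: "\<And>i. \<xi> ^ (N ^ i) \<noteq> 1"
  shows "leading_moment {..<M ^ k} (\<lambda>n. \<xi> ^ base_shift M N n)
           (\<lambda>n. of_nat (base_shift M N n) * x + of_nat n * y) k
           (\<Prod>i<k. - (of_nat M * (of_nat N ^ i * x + of_nat M ^ i * y)) / (1 - \<xi> ^ (N ^ i)))"
proof (induction k)
  case 0
  \<comment> \<open>Only \<open>n = 0\<close> remains, with weight 1 and value 0; its zeroth moment
    is 1, the empty product.\<close>
  have "base_shift M N 0 = 0" by (simp add: base_shift_def digit_def)
  then show ?case by (simp add: leading_moment_def)
next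
  case (Suc k)
  \<comment> \<open>A unit of digit \<open>k\<close> adds \<open>N ^ k\<close> to the shifted number
    and \<open>M ^ k\<close> to the number itself.\<close>
  let ?a = "of_nat N ^ k * x + of_nat M ^ k * y"
  have "(\<xi> ^ (N ^ k)) ^ M = 1"
    using root by (metis mult.commute power_mult power_one)
  note digit = leading_moment_digit[OF this nontriv, of ?a]
  show ?case
    unfolding prod.lessThan_Suc
  proof (rule leading_moment_reindex[OF _ bij_betw_top_digit])
    show "leading_moment ({..<M ^ k} \<times> {..<M})
        (\<lambda>(n, q). \<xi> ^ base_shift M N n * (\<xi> ^ (N ^ k)) ^ q)
        (\<lambda>(n, q). (of_nat (base_shift M N n) * x + of_nat n * y) + of_nat q * ?a) (Suc k)
        ((\<Prod>i<k. - (of_nat M * (of_nat N ^ i * x + of_nat M ^ i * y)) / (1 - \<xi> ^ (N ^ i))) *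
         (- (of_nat M * ?a) / (1 - \<xi> ^ (N ^ k))))"
      using leading_moment_times[OF Suc.IH digit] by simp
  qed (use M in \<open>auto simp: base_shift_add_top_digit power_add power_mult[symmetric] algebra_simps\<close>)
qed

lemma leading_moment_PiE:
  assumes "finite J" and "\<And>j. j \<in> J \<Longrightarrow> leading_moment (A j) (W j) (V j) (d j) (L j)"
  shows "leading_moment (PiE J A) (\<lambda>n. \<Prod>j\<in>J. W j (n j)) (\<lambda>n. \<Sum>j\<in>J. V j (n j))
           (\<Sum>j\<in>J. d j) (\<Prod>j\<in>J. L j)"
  using assms
proof (induction J rule: finite_induct)
  case empty
  then show ?case by (simp add: leading_moment_def)
next
  case (insert j J)
  \<comment> \<open>A choice function on \<open>insert j J\<close> is a value at \<open>j\<close>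
    together with a choice function on \<open>J\<close>, so the product rule for two factors
    applies.\<close>
  have bij: "bij_betw (\<lambda>(a, n). n(j := a)) (A j \<times> PiE J A) (PiE (insert j J) A)"
    unfolding bij_betw_def using insert.hyps inj_combinator[of j J A]
    by (simp add: PiE_insert_eq)
  have upd: "(\<Prod>i\<in>J. W i ((n(j := a)) i)) = (\<Prod>i\<in>J. W i (n i))"
    "(\<Sum>i\<in>J. V i ((n(j := a)) i)) = (\<Sum>i\<in>J. V i (n i))" for n a
    using insert.hyps by (auto intro!: prod.cong sum.cong)
  have "leading_moment (A j) (W j) (V j) (d j) (L j)" using insert.prems by simp
  from leading_moment_times[OF this insert.IH] insert.prems
  have "leading_moment (A j \<times> PiE J A) (\<lambda>(a, n). W j a * (\<Prod>i\<in>J. W i (n i)))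
      (\<lambda>(a, n). V j a + (\<Sum>i\<in>J. V i (n i))) (\<Sum>i\<in>insert j J. d i) (\<Prod>i\<in>insert j J. L i)"
    using insert.hyps by simp
  from this bij show ?case
    by (rule leading_moment_reindex) (use insert.hyps upd in \<open>auto simp del: fun_upd_apply\<close>, simp_all)
qed

text \<open>A prime dividing \<open>M\<close> divides a power of \<open>N\<close>, hence
  \<open>N\<close> itself. Positivity excludes \<open>N = 0\<close>, whose set of prime factors is
  empty by convention.\<close>

lemma rad_dvd_rad_if_dvd_power:
  assumes "M dvd N ^ i" and "N > 0"
  shows "rad M dvd rad N"
  unfolding rad_def
proof (rule prod_dvd_prod_subset)
  show "prime_factors M \<subseteq> prime_factors N"
    using assms by (auto simp: prime_factors_dvd intro: prime_dvd_power dvd_trans)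
qed simp

text \<open>Otherwise the remainder \<open>k mod m\<close> would be a positive exponent below
  \<open>m\<close> giving 1.\<close>

lemma primitive_root_of_unity_power_eq_1D:
  assumes "primitive_root_of_unity m z" and "z ^ k = 1"
  shows "m dvd k"
proof (rule ccontr)
  assume "\<not> m dvd k"
  moreover have "m > 0" using assms(1) by (simp add: primitive_root_of_unity_def)
  ultimately have "0 < k mod m" "k mod m < m" by (auto simp: dvd_eq_mod_eq_0)
  moreover have "z ^ k = (z ^ m) ^ (k div m) * z ^ (k mod m)"
    by (simp add: power_mult[symmetric] power_add[symmetric])
  then have "z ^ (k mod m) = 1" using assms by (simp add: primitive_root_of_unity_def)
  ultimately show False using assms(1) by (auto simp: primitive_root_of_unity_def)
qed

theorem theorem5p6:
  fixes M N r D :: nat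
    and p :: "nat \<Rightarrow> nat"
    and \<xi> :: complex
    and x y :: "nat \<Rightarrow> complex"
  assumes "M \<ge> 2" and "N \<ge> 1"
    and "\<not> rad M dvd rad N"
    and "primitive_root_of_unity M \<xi>"
    and "r \<ge> 1"
    and "D = (\<Sum>j=1..r. p j + 1)"
  shows "(\<Sum>n \<in> PiE {1..r} (\<lambda>j. {0..<M ^ (p j + 1)}).
            \<xi> ^ (\<Sum>j=1..r. base_shift M N (n j)) *
            (\<Sum>j=1..r. of_nat (base_shift M N (n j)) * x j + of_nat (n j) * y j) ^ D) =
         (-1) ^ D * fact D * of_nat M ^ D *
           ((\<Prod>j=1..r. \<Prod>i=0..p j. of_nat N ^ i * x j + of_nat M ^ i * y j) /
            (\<Prod>j=1..r. \<Prod>i=0..p j. 1 - \<xi> ^ (N ^ i)))"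
proof -
  have root: "\<xi> ^ M = 1" using assms(4) by (simp add: primitive_root_of_unity_def)
  \<comment> \<open>If this power were 1, then \<open>M\<close> would divide \<open>N ^ i\<close>,
    against the hypothesis on radicals.\<close>
  have nontriv: "\<xi> ^ (N ^ i) \<noteq> 1" for i
    using primitive_root_of_unity_power_eq_1D[OF assms(4)] rad_dvd_rad_if_dvd_power assms(2,3)
    by (metis less_eq_Suc_le One_nat_def)
  have "leading_moment (PiE {1..r} (\<lambda>j. {..<M ^ (p j + 1)}))
      (\<lambda>n. \<Prod>j=1..r. \<xi> ^ base_shift M N (n j))
      (\<lambda>n. \<Sum>j=1..r. of_nat (base_shift M N (n j)) * x j + of_nat (n j) * y j) D
      (\<Prod>j=1..r. \<Prod>i<p j + 1.
         - (of_nat M * (of_nat N ^ i * x j + of_nat M ^ i * y j)) / (1 - \<xi> ^ (N ^ i)))"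
    unfolding assms(6)
    by (intro leading_moment_PiE leading_moment_base_shift assms(1) root nontriv) simp
  \<comment> \<open>Each of the \<open>p j + 1\<close> positions of each \<open>j\<close>
    contributes one factor \<open>- M\<close>, hence \<open>D\<close> of them in all.\<close>
  moreover have "(\<Prod>j=1..r. \<Prod>i<p j + 1.
        - (of_nat M * (of_nat N ^ i * x j + of_nat M ^ i * y j)) / (1 - \<xi> ^ (N ^ i)))
      = (- of_nat M) ^ D *
        ((\<Prod>j=1..r. \<Prod>i=0..p j. of_nat N ^ i * x j + of_nat M ^ i * y j) /
         (\<Prod>j=1..r. \<Prod>i=0..p j. 1 - \<xi> ^ (N ^ i)))"
  proof -
    have "(\<Prod>j=1..r. \<Prod>i<p j + 1.
        - (of_nat M * (of_nat N ^ i * x j + of_nat M ^ i * y j)) / (1 - \<xi> ^ (N ^ i)))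
      = (\<Prod>j=1..r. \<Prod>i=0..p j.
        (- of_nat M) * ((of_nat N ^ i * x j + of_nat M ^ i * y j) / (1 - \<xi> ^ (N ^ i))))"
      by (intro prod.cong) auto
    also have "\<dots> = (\<Prod>j=1..r. (- of_nat M) ^ (p j + 1)) *
        ((\<Prod>j=1..r. \<Prod>i=0..p j. of_nat N ^ i * x j + of_nat M ^ i * y j) /
         (\<Prod>j=1..r. \<Prod>i=0..p j. 1 - \<xi> ^ (N ^ i)))"
      unfolding prod.distrib prod_dividef prod_constant by simp
    also have "(\<Prod>j=1..r. (- of_nat M) ^ (p j + 1)) = (- of_nat M :: complex) ^ D"
      unfolding assms(6) by (rule power_sum[symmetric])
    finally show ?thesis .
  qed
  moreover have "(- of_nat M :: complex) ^ D = (-1) ^ D * of_nat M ^ D"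
    by (rule power_minus)
  ultimately show ?thesis
    by (simp only: leading_moment_def power_sum lessThan_atLeast0 mult_ac)
qed

end
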